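(* Let $\mathsf L\in\{\mathsf L_\Diamond,\mathsf L^\forall_\Diamond\}$, let $\mathcal A,\mathcal B$ be classes of frames, let $\mu:\mathsf L\to\mathbb N$ be any complexity measure, and let $m\in\mathbb N$. Then the following are equivalent: (1) Hercules has a winning strategy for the $(\mathsf L,\langle\mathcal A,\mathcal B\rangle)$ formula-complexity game on frames with $\mu$ below $m$; (2) there is an $\mathsf L$-formula $\varphi$ with $\mu(\varphi)<m$ that is valid on every frame of $\mathcal A$ and not valid on any frame of $\mathcal B$.
   Context: Fix a countably infinite set $P$ of propositional variables. $\mathsf L^\forall_\Diamond$ is the set of negation-normal-form formulas built from literals $p,\overline p$ ($p\in P$), $\bot,\top$ with $\vee,\wedge,\Diamond,\Box,\exists,\forall$ (universal modalities); $\mathsf L_\Diamond$ is the fragment without $\exists,\forall$. A frame is $(W,R)$, $W\neq\emptyset$, $R\subseteq W\times W$; a model based on it adds $V:W\to2^P$; pointed models $(\mathcal M,a)$; standard Kripke semantics; a formula is valid on a frame if true at all points under all valuations. For $\mathbf a=(\mathcal M,a)$: $\Box\mathbf a=\{(\mathcal M,b):aRb\}$, $\forall\mathbf a=\{(\mathcal M,b):b\in W\}$. Game on models $(\mathsf L,\langle\mathcal C,\mathcal D\rangle)$ (classes of pointed models): Hercules and the Hydra build a tree whose nodes $\eta$ carry a pair $\langle\mathfrak L(\eta),\mathfrak R(\eta)\rangle$ and a symbol; the root is labelled $\langle\mathcal C,\mathcal D\rangle$ and is a head. While heads remain, Hercules picks a head $\eta$ and plays: Literal $\iota$ with $\mathfrak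 L(\eta)\models\iota$, $\mathfrak R(\eta)\models\neg\iota$ (stub); $\bot$ if $\mathfrak L(\eta)=\emptyset$ (stub); $\top$ if $\mathfrak R(\eta)=\emptyset$ (stub); $\vee$: split $\mathfrak L(\eta)=\mathcal L_1\cup\mathcal L_2$, daughter heads $\langle\mathcal L_i,\mathfrak R(\eta)\rangle$; $\wedge$: split $\mathfrak R(\eta)=\mathcal R_1\cup\mathcal R_2$, daughters $\langle\mathfrak L(\eta),\mathcal R_i\rangle$; $\Diamond$: Hercules picks one element of $\Box\mathbf l$ for each $\mathbf l\in\mathfrak L(\eta)$ (impossible if one is empty), the Hydra picks a subset of $\Box\mathbf r$ for each $\mathbf r\in\mathfrak R(\eta)$, giving one daughter head; $\Box$: dual (Hercules chooses for the right side, the Hydra subsets for the left); $\exists,\forall$ (only in $\mathsf L^\forall_\Diamond$): as $\Diamond,\Box$ with $\forall\mathbf a$ instead of $\Box\mathbf a$. The game ends when no heads remain, with closed tree $T$; $\psi_T$ is the formula whose syntax tree is $T$, $\mu(T)=\mu(\psi_T)$. Game on frames $(\mathsf L,\langle\mathcal A,\mathcal B\rangle)$: first Hercules chooses, for each $\mathcal F\in\mathcal B$, a model based on $\mathcal F$ and a point in it, forming a class $\mathcal B'$ of pointed models; then the Hydra chooses an arbitrary class $\mathcal A'$ of pointed models each based on some frame of $\mathcal A$; then they play the game on models $(\mathsf L,\langle\mathcal A',\mathcal B'\rangle)$, whose tree is the tree of the match. Hercules has a winning strategy with $\mu$ below $m$ if, however the Hydra plays, the match terminates in finite time with a closed tree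 $T$ with $\mu(T)<m$. *)

theory Defs
  imports Main "HOL-Library.Countable" "HOL-Library.Infinite_Typeclass"
begin

datatype 'p literal = Pos 'p | Neg 'p

datatype 'p fm =
    Lit "'p literal" | Bot | Top
  | Or "'p fm" "'p fm" | And "'p fm" "'p fm"
  | Dia "'p fm" | Box "'p fm"
  | UEx "'p fm" | UAll "'p fm"

datatype lang = L_Dia | L_Dia_U

primrec no_univ :: "'p fm \<Rightarrow> bool" where
  "no_univ (Lit l) = True"
| "no_univ Bot = True"
| "no_univ Top = True"
| "no_univ (Or \<phi> \<psi>) = (no_univ \<phi> \<and> no_univ \<psi>)"
| "no_univ (And \<phi> \<psi>) = (no_univ \<phi> \<and> no_univ \<psi>)"
| "no_univ (Dia \<phi>) = no_univ \<phi>"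
| "no_univ (Box \<phi>) = no_univ \<phi>"
| "no_univ (UEx \<phi>) = False"
| "no_univ (UAll \<phi>) = False"

fun formulas :: "lang \<Rightarrow> 'p fm set" where
  "formulas L_Dia = {\<phi>. no_univ \<phi>}"
| "formulas L_Dia_U = UNIV"

record 'w kframe =
  worlds :: "'w set"
  rel :: "('w \<times> 'w) set"

record ('w, 'p) kmodel = "'w kframe" +
  val :: "'w \<Rightarrow> 'p set"

definition is_frame :: "('w, 'x) kframe_scheme \<Rightarrow> bool" where
  "is_frame F \<longleftrightarrow> worlds F \<noteq> {} \<and> rel F \<subseteq> worlds F \<times> worlds F"

text \<open>A valuation is a function on the worlds of the model only. It is represented by a
  total function that is empty elsewhere, so that equality of models is as expected.\<close>

definition is_model :: "('w, 'p) kmodel \<Rightarrow> bool" where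
  "is_model M \<longleftrightarrow> is_frame M \<and> (\<forall>w. w \<notin> worlds M \<longrightarrow> val M w = {})"

definition model_on :: "('w, 'p) kmodel \<Rightarrow> 'w kframe \<Rightarrow> bool" where
  "model_on M F \<longleftrightarrow> is_model M \<and> worlds M = worlds F \<and> rel M = rel F"

type_synonym ('w, 'p) pmodel = "('w, 'p) kmodel \<times> 'w"

definition pmodel_on :: "('w, 'p) pmodel \<Rightarrow> 'w kframe \<Rightarrow> bool" where
  "pmodel_on a F \<longleftrightarrow> model_on (fst a) F \<and> snd a \<in> worlds F"

fun lit_true :: "('w, 'p) pmodel \<Rightarrow> 'p literal \<Rightarrow> bool" where
  "lit_true (M, a) (Pos p) \<longleftrightarrow> p \<in> val M a"
| "lit_true (M, a) (Neg p) \<longleftrightarrow> p \<notin> val M a"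

primrec sat :: "('w, 'p) kmodel \<Rightarrow> 'w \<Rightarrow> 'p fm \<Rightarrow> bool" where
  "sat M a (Lit l) \<longleftrightarrow> lit_true (M, a) l"
| "sat M a Bot \<longleftrightarrow> False"
| "sat M a Top \<longleftrightarrow> True"
| "sat M a (Or \<phi> \<psi>) \<longleftrightarrow> sat M a \<phi> \<or> sat M a \<psi>"
| "sat M a (And \<phi> \<psi>) \<longleftrightarrow> sat M a \<phi> \<and> sat M a \<psi>"
| "sat M a (Dia \<phi>) \<longleftrightarrow> (\<exists>b. (a, b) \<in> rel M \<and> sat M b \<phi>)"
| "sat M a (Box \<phi>) \<longleftrightarrow> (\<forall>b. (a, b) \<in> rel M \<longrightarrow> sat M b \<phi>)"
| "sat M a (UEx \<phi>) \<longleftrightarrow> (\<exists>b \<in> worlds M. sat M b \<phi>)"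
| "sat M a (UAll \<phi>) \<longleftrightarrow> (\<forall>b \<in> worlds M. sat M b \<phi>)"

definition valid_on :: "'w kframe \<Rightarrow> 'p fm \<Rightarrow> bool" where
  "valid_on F \<phi> \<longleftrightarrow> (\<forall>M a. model_on M F \<longrightarrow> a \<in> worlds F \<longrightarrow> sat M a \<phi>)"

fun successors :: "('w, 'p) pmodel \<Rightarrow> ('w, 'p) pmodel set" where
  "successors (M, a) = {(M, b) | b. (a, b) \<in> rel M}"

fun all_points :: "('w, 'p) pmodel \<Rightarrow> ('w, 'p) pmodel set" where
  "all_points (M, a) = {(M, b) | b. b \<in> worlds M}"

datatype 'p stub_sym = SLit "'p literal" | SBot | STop
datatype bin_sym = SOr | SAnd
datatype modal_sym = SDia | SBox | SEx | SAll

text \<open>The two sets carried by every node are its labels \<open>\<LL>(\<eta>)\<close> and \<open>\<RR>(\<eta>)\<close>.\<close>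

datatype ('w, 'p) gtree =
    Head "('w, 'p) pmodel set" "('w, 'p) pmodel set"
  | Stub "('w, 'p) pmodel set" "('w, 'p) pmodel set" "'p stub_sym"
  | Binary "('w, 'p) pmodel set" "('w, 'p) pmodel set" bin_sym "('w, 'p) gtree" "('w, 'p) gtree"
  | Modal "('w, 'p) pmodel set" "('w, 'p) pmodel set" modal_sym "('w, 'p) gtree"

primrec closed_tree :: "('w, 'p) gtree \<Rightarrow> bool" where
  "closed_tree (Head L R) = False"
| "closed_tree (Stub L R s) = True"
| "closed_tree (Binary L R s t u) = (closed_tree t \<and> closed_tree u)"
| "closed_tree (Modal L R s t) = closed_tree t"

text \<open>The formula \<open>\<psi>\<^sub>T\<close> whose syntax tree is \<open>T\<close>; only meaningful for closed trees.\<close>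

fun tree_fm :: "('w, 'p) gtree \<Rightarrow> 'p fm" where
  "tree_fm (Head L R) = undefined"
| "tree_fm (Stub L R (SLit l)) = Lit l"
| "tree_fm (Stub L R SBot) = Bot"
| "tree_fm (Stub L R STop) = Top"
| "tree_fm (Binary L R SOr t u) = Or (tree_fm t) (tree_fm u)"
| "tree_fm (Binary L R SAnd t u) = And (tree_fm t) (tree_fm u)"
| "tree_fm (Modal L R SDia t) = Dia (tree_fm t)"
| "tree_fm (Modal L R SBox t) = Box (tree_fm t)"
| "tree_fm (Modal L R SEx t) = UEx (tree_fm t)"
| "tree_fm (Modal L R SAll t) = UAll (tree_fm t)"

text \<open>A node is addressed by the path leading to it from the root; the single daughter of a
  \<open>Modal\<close> node is its \<open>First\<close> one.\<close>

datatype daughter = First | Second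

fun head_at :: "('w, 'p) gtree \<Rightarrow> daughter list
    \<Rightarrow> (('w, 'p) pmodel set \<times> ('w, 'p) pmodel set) option" where
  "head_at (Head L R) [] = Some (L, R)"
| "head_at (Binary L R s t u) (First # \<eta>) = head_at t \<eta>"
| "head_at (Binary L R s t u) (Second # \<eta>) = head_at u \<eta>"
| "head_at (Modal L R s t) (First # \<eta>) = head_at t \<eta>"
| "head_at _ _ = None"

fun graft :: "('w, 'p) gtree \<Rightarrow> daughter list \<Rightarrow> ('w, 'p) gtree \<Rightarrow> ('w, 'p) gtree" where
  "graft (Head L R) [] v = v"
| "graft (Binary L R s t u) (First # \<eta>) v = Binary L R s (graft t \<eta> v) u"
| "graft (Binary L R s t u) (Second # \<eta>) v = Binary L R s t (graft u \<eta> v)"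
| "graft (Modal L R s t) (First # \<eta>) v = Modal L R s (graft t \<eta> v)"
| "graft t _ _ = t"

datatype ('w, 'p) move =
    Play_Stub "'p stub_sym"
  | Play_Split bin_sym "('w, 'p) pmodel set" "('w, 'p) pmodel set"
  | Play_Modal modal_sym "('w, 'p) pmodel \<Rightarrow> ('w, 'p) pmodel"

type_synonym ('w, 'p) reply = "('w, 'p) pmodel \<Rightarrow> ('w, 'p) pmodel set"

fun accessible :: "modal_sym \<Rightarrow> ('w, 'p) pmodel \<Rightarrow> ('w, 'p) pmodel set" where
  "accessible SDia a = successors a"
| "accessible SBox a = successors a"
| "accessible SEx a = all_points a"
| "accessible SAll a = all_points a"

fun hercules_side ::
  "modal_sym \<Rightarrow> ('w, 'p) pmodel set \<Rightarrow> ('w, 'p) pmodel set \<Rightarrow> ('w, 'p) pmodel set" where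
  "hercules_side SDia L R = L"
| "hercules_side SEx L R = L"
| "hercules_side SBox L R = R"
| "hercules_side SAll L R = R"

fun hydra_side ::
  "modal_sym \<Rightarrow> ('w, 'p) pmodel set \<Rightarrow> ('w, 'p) pmodel set \<Rightarrow> ('w, 'p) pmodel set" where
  "hydra_side SDia L R = R"
| "hydra_side SEx L R = R"
| "hydra_side SBox L R = L"
| "hydra_side SAll L R = L"

fun legal_move ::
  "lang \<Rightarrow> ('w, 'p) pmodel set \<Rightarrow> ('w, 'p) pmodel set \<Rightarrow> ('w, 'p) move \<Rightarrow> bool" where
  "legal_move \<Lambda> L R (Play_Stub (SLit l)) \<longleftrightarrow>
     (\<forall>a \<in> L. lit_true a l) \<and> (\<forall>a \<in> R. \<not> lit_true a l)"
| "legal_move \<Lambda> L R (Play_Stub SBot) \<longleftrightarrow> L = {}"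
| "legal_move \<Lambda> L R (Play_Stub STop) \<longleftrightarrow> R = {}"
| "legal_move \<Lambda> L R (Play_Split SOr X Y) \<longleftrightarrow> L = X \<union> Y"
| "legal_move \<Lambda> L R (Play_Split SAnd X Y) \<longleftrightarrow> R = X \<union> Y"
| "legal_move \<Lambda> L R (Play_Modal s f) \<longleftrightarrow>
     (s \<in> {SEx, SAll} \<longrightarrow> \<Lambda> = L_Dia_U) \<and>
     (\<forall>a \<in> hercules_side s L R. f a \<in> accessible s a)"

text \<open>The Hydra replies to modal moves only; in all other cases, and for pointed models that
  are not on her side, the reply is fixed to be empty.\<close>

fun legal_reply :: "('w, 'p) pmodel set \<Rightarrow> ('w, 'p) pmodel set \<Rightarrow> ('w, 'p) move
    \<Rightarrow> ('w, 'p) reply \<Rightarrow> bool" where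
  "legal_reply L R (Play_Modal s f) g \<longleftrightarrow>
     (\<forall>a. g a \<subseteq> (if a \<in> hydra_side s L R then accessible s a else {}))"
| "legal_reply L R _ g \<longleftrightarrow> (\<forall>a. g a = {})"

text \<open>The subtree that replaces the head labelled \<open>L\<close>, \<open>R\<close>.\<close>

fun expand :: "('w, 'p) pmodel set \<Rightarrow> ('w, 'p) pmodel set \<Rightarrow> ('w, 'p) move
    \<Rightarrow> ('w, 'p) reply \<Rightarrow> ('w, 'p) gtree" where
  "expand L R (Play_Stub s) g = Stub L R s"
| "expand L R (Play_Split SOr X Y) g = Binary L R SOr (Head X R) (Head Y R)"
| "expand L R (Play_Split SAnd X Y) g = Binary L R SAnd (Head L X) (Head L Y)"
| "expand L R (Play_Modal SDia f) g = Modal L R SDia (Head (f ` L) (\<Union>a \<in> R. g a))"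
| "expand L R (Play_Modal SEx f) g = Modal L R SEx (Head (f ` L) (\<Union>a \<in> R. g a))"
| "expand L R (Play_Modal SBox f) g = Modal L R SBox (Head (\<Union>a \<in> L. g a) (f ` R))"
| "expand L R (Play_Modal SAll f) g = Modal L R SAll (Head (\<Union>a \<in> L. g a) (f ` R))"

text \<open>A round consists of the head picked by Hercules, his move there, and the Hydra's reply.
  A strategy for Hercules may depend on all earlier rounds (oldest first).\<close>

type_synonym ('w, 'p) round = "daughter list \<times> ('w, 'p) move \<times> ('w, 'p) reply"

type_synonym ('w, 'p) strategy = "('w, 'p) round list \<Rightarrow> daughter list \<times> ('w, 'p) move"

fun play_round :: "('w, 'p) gtree \<Rightarrow> ('w, 'p) round \<Rightarrow> ('w, 'p) gtree" where
  "play_round T (\<eta>, mv, g) =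
     (case head_at T \<eta> of None \<Rightarrow> T | Some (L, R) \<Rightarrow> graft T \<eta> (expand L R mv g))"

definition position :: "('w, 'p) pmodel set \<Rightarrow> ('w, 'p) pmodel set \<Rightarrow> ('w, 'p) round list
    \<Rightarrow> ('w, 'p) gtree" where
  "position C D h = foldl play_round (Head C D) h"

definition legal_turn :: "lang \<Rightarrow> ('w, 'p) gtree \<Rightarrow> daughter list \<times> ('w, 'p) move \<Rightarrow> bool" where
  "legal_turn \<Lambda> T x \<longleftrightarrow>
     (\<exists>L R. head_at T (fst x) = Some (L, R) \<and> legal_move \<Lambda> L R (snd x))"

text \<open>The finite initial parts of matches in which Hercules follows \<open>\<sigma>\<close>.\<close>

inductive partial_match :: "lang \<Rightarrow> ('w, 'p) pmodel set \<Rightarrow> ('w, 'p) pmodel set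
    \<Rightarrow> ('w, 'p) strategy \<Rightarrow> ('w, 'p) round list \<Rightarrow> bool"
  for \<Lambda> C D \<sigma> where
  start: "partial_match \<Lambda> C D \<sigma> []"
| round: "\<lbrakk> partial_match \<Lambda> C D \<sigma> h; \<sigma> h = (\<eta>, mv);
     head_at (position C D h) \<eta> = Some (L, R); legal_move \<Lambda> L R mv; legal_reply L R mv g \<rbrakk>
     \<Longrightarrow> partial_match \<Lambda> C D \<sigma> (h @ [(\<eta>, mv, g)])"

text \<open>A complexity measure on the language \<open>\<Lambda>\<close> is represented by a total function \<open>\<mu>\<close>;
  its values outside \<open>formulas \<Lambda>\<close> are never used. The lengths of the matches need not be
  uniformly bounded.\<close>

definition winning_on_models :: "lang \<Rightarrow> ('p fm \<Rightarrow> nat) \<Rightarrow> nat \<Rightarrow> ('w, 'p) pmodel set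
    \<Rightarrow> ('w, 'p) pmodel set \<Rightarrow> ('w, 'p) strategy \<Rightarrow> bool" where
  "winning_on_models \<Lambda> \<mu> m C D \<sigma> \<longleftrightarrow>
     (\<forall>h. partial_match \<Lambda> C D \<sigma> h \<longrightarrow>
        (if closed_tree (position C D h) then \<mu> (tree_fm (position C D h)) < m
         else legal_turn \<Lambda> (position C D h) (\<sigma> h))) \<and>
     \<not> (\<exists>s. \<forall>n. partial_match \<Lambda> C D \<sigma> (map s [0..<n]))"

text \<open>A strategy for Hercules on frames consists of the choice \<open>\<beta>\<close> of a pointed model on each
  frame of \<open>B\<close>, and a strategy for the game on models, which may depend on the class \<open>A'\<close>
  subsequently chosen by the Hydra.\<close>

definition winning_on_frames :: "lang \<Rightarrow> ('p fm \<Rightarrow> nat) \<Rightarrow> nat \<Rightarrow> 'w kframe set \<Rightarrow> 'w kframe set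
    \<Rightarrow> ('w kframe \<Rightarrow> ('w, 'p) pmodel) \<Rightarrow> (('w, 'p) pmodel set \<Rightarrow> ('w, 'p) strategy) \<Rightarrow> bool" where
  "winning_on_frames \<Lambda> \<mu> m A B \<beta> \<sigma> \<longleftrightarrow>
     (\<forall>F \<in> B. pmodel_on (\<beta> F) F) \<and>
     (\<forall>A'. (\<forall>a \<in> A'. \<exists>F \<in> A. pmodel_on a F) \<longrightarrow>
        winning_on_models \<Lambda> \<mu> m A' (\<beta> ` B) (\<sigma> A'))"

definition hercules_wins_on_frames :: "lang \<Rightarrow> ('p fm \<Rightarrow> nat) \<Rightarrow> nat \<Rightarrow> 'w kframe set
    \<Rightarrow> 'w kframe set \<Rightarrow> bool" where
  "hercules_wins_on_frames \<Lambda> \<mu> m A B \<longleftrightarrow> (\<exists>\<beta> \<sigma>. winning_on_frames \<Lambda> \<mu> m A B \<beta> \<sigma>)"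

end

theory Submission
  imports Defs
begin

text \<open>A formula \<open>\<phi>\<close> true on the left and false on the right of a node tells Hercules how to move
  there: his play copies the syntax tree of \<open>\<phi>\<close>, so the match ends with \<open>\<psi>\<^sub>T = \<phi>\<close>. Conversely,
  let the Hydra choose all pointed models based on frames of \<open>A\<close> and always reply with all
  accessible points. The closed tree of the resulting match is then a certificate that \<open>\<psi>\<^sub>T\<close> is
  true on the left and false on the right of each of its nodes, in particular of the root.\<close>

section \<open>Connectives by node symbol, and truth at pointed models\<close>

primrec bin_fm :: "bin_sym \<Rightarrow> 'p fm \<Rightarrow> 'p fm \<Rightarrow> 'p fm" where
  "bin_fm SOr = Or"
| "bin_fm SAnd = And"

primrec modal_fm :: "modal_sym \<Rightarrow> 'p fm \<Rightarrow> 'p fm" where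
  "modal_fm SDia = Dia"
| "modal_fm SBox = Box"
| "modal_fm SEx = UEx"
| "modal_fm SAll = UAll"

lemma bin_fm_inject [simp]: "bin_fm s \<alpha> \<beta> = bin_fm s \<alpha>' \<beta>' \<longleftrightarrow> \<alpha> = \<alpha>' \<and> \<beta> = \<beta>'"
  by (cases s) auto

lemma tree_fm_Binary: "tree_fm (Binary L R s t u) = bin_fm s (tree_fm t) (tree_fm u)"
  by (cases s) auto

lemma tree_fm_Modal: "tree_fm (Modal L R s t) = modal_fm s (tree_fm t)"
  by (cases s) auto

definition holds :: "('w, 'p) pmodel \<Rightarrow> 'p fm \<Rightarrow> bool" where
  "holds a \<phi> \<longleftrightarrow> sat (fst a) (snd a) \<phi>"

text \<open>Bounded quantifiers over \<open>successors\<close> and \<open>all_points\<close> match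
  the sets from which both players choose. Both functions are kept folded afterwards, so models need
  not be taken apart again.\<close>

lemma holds_simps [simp]:
  "holds a (Lit l) \<longleftrightarrow> lit_true a l"
  "holds a Bot \<longleftrightarrow> False"
  "holds a Top \<longleftrightarrow> True"
  "holds a (Or \<phi> \<psi>) \<longleftrightarrow> holds a \<phi> \<or> holds a \<psi>"
  "holds a (And \<phi> \<psi>) \<longleftrightarrow> holds a \<phi> \<and> holds a \<psi>"
  "holds a (Dia \<phi>) \<longleftrightarrow> (\<exists>b \<in> successors a. holds b \<phi>)"
  "holds a (Box \<phi>) \<longleftrightarrow> (\<forall>b \<in> successors a. holds b \<phi>)"
  "holds a (UEx \<phi>) \<longleftrightarrow> (\<exists>b \<in> all_points a. holds b \<phi>)"
  "holds a (UAll \<phi>) \<longleftrightarrow> (\<forall>b \<in> all_points a. holds b \<phi>)"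
  by (cases a; force simp: holds_def)+

declare successors.simps [simp del] all_points.simps [simp del]

definition separates :: "'p fm \<Rightarrow> ('w, 'p) pmodel set \<Rightarrow> ('w, 'p) pmodel set \<Rightarrow> bool" where
  "separates \<phi> L R \<longleftrightarrow> (\<forall>a \<in> L. holds a \<phi>) \<and> (\<forall>a \<in> R. \<not> holds a \<phi>)"

lemma position_Nil [simp]: "position C D [] = Head C D"
  by (simp add: position_def)

lemma position_snoc [simp]:
  "position C D (h @ [x]) = play_round (position C D h) x"
  by (simp add: position_def)


lemma head_at_closed_tree: "closed_tree T \<Longrightarrow> head_at T \<eta> = None"
  by (induction T \<eta> rule: head_at.induct) auto


subsection \<open>Playing a formula\<close>

text \<open>The tree is an initial part of the syntax tree of the formula, where the subformula
  still to be played at each head separates its two sides. Labels of inner nodes are unconstrained,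
  since only heads are played on.\<close>

primrec follows :: "('w, 'p) gtree \<Rightarrow> 'p fm \<Rightarrow> bool" where
  "follows (Head L R) = (\<lambda>\<phi>. separates \<phi> L R)"
| "follows (Stub L R s) = (\<lambda>\<phi>. \<phi> = tree_fm (Stub L R s))"
| "follows (Binary L R s t u) =
     (\<lambda>\<phi>. \<exists>\<alpha> \<beta>. \<phi> = bin_fm s \<alpha> \<beta> \<and> follows t \<alpha> \<and> follows u \<beta>)"
| "follows (Modal L R s t) = (\<lambda>\<phi>. \<exists>\<alpha>. \<phi> = modal_fm s \<alpha> \<and> follows t \<alpha>)"

lemma tree_fm_follows: "closed_tree T \<Longrightarrow> follows T \<phi> \<Longrightarrow> tree_fm T = \<phi>"
  by (induction T arbitrary: \<phi>) (auto simp: tree_fm_Binary tree_fm_Modal simp del: tree_fm.simps(5-))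

text \<open>Serves as the number of rounds so far: each round turns exactly one head into a node of
  another kind.\<close>

primrec played :: "('w, 'p) gtree \<Rightarrow> nat" where
  "played (Head L R) = 0"
| "played (Stub L R s) = 1"
| "played (Binary L R s t u) = Suc (played t + played u)"
| "played (Modal L R s t) = Suc (played t)"

text \<open>The generated \<open>size\<close> is 0 on literals, \<open>\<bottom>\<close> and \<open>\<top>\<close>, whereas stubs count as played.\<close>

lemma played_follows: "follows T \<phi> \<Longrightarrow> played T \<le> 2 * size \<phi> + 1"
proof (induction T arbitrary: \<phi>)
  case (Binary L R s t u)
  then show ?case by (cases s) fastforce+
next
  case (Modal L R s t)
  then show ?case by (cases s) fastforce+
qed auto

lemma played_expand: "played (expand L R mv g) = 1"
  by (cases "(L, R, mv, g)" rule: expand.cases) auto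

lemma played_graft:
  "head_at T \<eta> = Some (L, R) \<Longrightarrow> played v = 1 \<Longrightarrow> played (graft T \<eta> v) = Suc (played T)"
  by (induction T \<eta> rule: head_at.induct) auto

text \<open>The main connective names the move. Splits go by truth of the two subformulas; in modal
  moves Hercules picks witnesses on his side, and the absence of witnesses on the other side makes
  every reply of the Hydra harmless.\<close>

lemma separating_move:
  assumes "separates \<phi> L R" and "\<phi> \<in> formulas \<Lambda>"
  shows "\<exists>mv. legal_move \<Lambda> L R mv \<and>
    (\<forall>g. legal_reply L R mv g \<longrightarrow> follows (expand L R mv g) \<phi>)"
proof (cases \<phi>)
  case (Lit l)
  then show ?thesis using assms
    by (intro exI[of _ "Play_Stub (SLit l)"]) (auto simp: separates_def)
next
  case Bot
  then show ?thesis using assms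
    by (intro exI[of _ "Play_Stub SBot"]) (auto simp: separates_def)
next
  case Top
  then show ?thesis using assms
    by (intro exI[of _ "Play_Stub STop"]) (auto simp: separates_def)
next
  case (Or \<alpha> \<beta>)
  then show ?thesis using assms
    by (intro exI[of _ "Play_Split SOr {a \<in> L. holds a \<alpha>}
        {a \<in> L. holds a \<beta>}"]) (auto simp: separates_def)
next
  case (And \<alpha> \<beta>)
  then show ?thesis using assms
    by (intro exI[of _ "Play_Split SAnd {a \<in> R. \<not> holds a \<alpha>}
        {a \<in> R. \<not> holds a \<beta>}"]) (auto simp: separates_def)
next
  case (Dia \<alpha>)
  with assms have "\<forall>a \<in> L. \<exists>b \<in> successors a. holds b \<alpha>"
    by (force simp: separates_def)
  then obtain f where f: "\<forall>a \<in> L. f a \<in> successors a \<and> holds (f a) \<alpha>"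
    by metis
  \<comment> \<open>No successor on the Hydra's side satisfies \<alpha>, so neither does any member
    of the subsets she may choose.\<close>
  have "\<forall>a \<in> R. \<forall>b \<in> successors a. \<not> holds b \<alpha>"
    using assms Dia by (force simp: separates_def)
  with f Dia show ?thesis
    by (intro exI[of _ "Play_Modal SDia f"]) (fastforce simp: separates_def split: if_splits)
next
  case (Box \<alpha>)
  with assms have "\<forall>a \<in> R. \<exists>b \<in> successors a. \<not> holds b \<alpha>"
    by (force simp: separates_def)
  then obtain f where f: "\<forall>a \<in> R. f a \<in> successors a \<and> \<not> holds (f a) \<alpha>"
    by metis
  have "\<forall>a \<in> L. \<forall>b \<in> successors a. holds b \<alpha>"
    using assms Box by (force simp: separates_def)
  with f Box show ?thesis
    by (intro exI[of _ "Play_Modal SBox f"]) (fastforce simp: separates_def split: if_splits)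
next
  case (UEx \<alpha>)
  with assms have \<Lambda>: "\<Lambda> = L_Dia_U"
    by (cases \<Lambda>) auto
  from UEx assms have "\<forall>a \<in> L. \<exists>b \<in> all_points a. holds b \<alpha>"
    by (force simp: separates_def)
  then obtain f where f: "\<forall>a \<in> L. f a \<in> all_points a \<and> holds (f a) \<alpha>"
    by metis
  have "\<forall>a \<in> R. \<forall>b \<in> all_points a. \<not> holds b \<alpha>"
    using assms UEx by (force simp: separates_def)
  with f UEx \<Lambda> show ?thesis
    by (intro exI[of _ "Play_Modal SEx f"]) (fastforce simp: separates_def split: if_splits)
next
  case (UAll \<alpha>)
  with assms have \<Lambda>: "\<Lambda> = L_Dia_U"
    by (cases \<Lambda>) auto
  from UAll assms have "\<forall>a \<in> R. \<exists>b \<in> all_points a. \<not> holds b \<alpha>"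
    by (force simp: separates_def)
  then obtain f where f: "\<forall>a \<in> R. f a \<in> all_points a \<and> \<not> holds (f a) \<alpha>"
    by metis
  have "\<forall>a \<in> L. \<forall>b \<in> all_points a. holds b \<alpha>"
    using assms UAll by (force simp: separates_def)
  with f UAll \<Lambda> show ?thesis
    by (intro exI[of _ "Play_Modal SAll f"]) (fastforce simp: separates_def split: if_splits)
qed

lemma bin_fm_in_formulas:
  "bin_fm s \<alpha> \<beta> \<in> formulas \<Lambda> \<longleftrightarrow> \<alpha> \<in> formulas \<Lambda> \<and> \<beta> \<in> formulas \<Lambda>"
  by (cases s; cases \<Lambda>) auto

lemma modal_fm_in_formulas:
  "modal_fm s \<alpha> \<in> formulas \<Lambda> \<longleftrightarrow>
     \<alpha> \<in> formulas \<Lambda> \<and> (s \<in> {SEx, SAll} \<longrightarrow> \<Lambda> = L_Dia_U)"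
  by (cases s; cases \<Lambda>) auto

text \<open>Strengthens \<open>legal_turn\<close>: whatever the Hydra replies, the invariant
  \<open>follows\<close> survives.\<close>

definition good_turn ::
  "lang \<Rightarrow> 'p fm \<Rightarrow> ('w, 'p) gtree \<Rightarrow> daughter list \<times> ('w, 'p) move \<Rightarrow> bool" where
  "good_turn \<Lambda> \<phi> T x \<longleftrightarrow> (\<exists>L R. head_at T (fst x) = Some (L, R) \<and> legal_move \<Lambda> L R (snd x) \<and>
     (\<forall>g. legal_reply L R (snd x) g \<longrightarrow> follows (graft T (fst x) (expand L R (snd x) g)) \<phi>))"

text \<open>Descending to an open head while decomposing \<phi> in parallel leads to a separating
  subformula, whose main connective gives the move.\<close>

lemma good_turn_exists:
  "follows T \<phi> \<Longrightarrow> \<phi> \<in> formulas \<Lambda> \<Longrightarrow> \<not> closed_tree T \<Longrightarrow> \<exists>x. good_turn \<Lambda> \<phi> T x"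
proof (induction T arbitrary: \<phi>)
  case (Head L R)
  then obtain mv where "legal_move \<Lambda> L R mv"
    "\<forall>g. legal_reply L R mv g \<longrightarrow> follows (expand L R mv g) \<phi>"
    using separating_move[of \<phi> L R \<Lambda>] by auto
  then show ?case
    by (intro exI[of _ "([], mv)"]) (simp add: good_turn_def)
next
  case (Stub L R s)
  then show ?case by simp
next
  case (Binary L R s t u)
  then obtain \<alpha> \<beta> where \<phi>: "\<phi> = bin_fm s \<alpha> \<beta>" "follows t \<alpha>" "follows u \<beta>"
    "\<alpha> \<in> formulas \<Lambda>" "\<beta> \<in> formulas \<Lambda>"
    by (auto simp: bin_fm_in_formulas)
  show ?case
  proof (cases "closed_tree t")
    case True
    with Binary \<phi> obtain \<eta> mv where "good_turn \<Lambda> \<beta> u (\<eta>, mv)"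
      by fastforce
    with \<phi> show ?thesis
      by (intro exI[of _ "(Second # \<eta>, mv)"]) (auto simp: good_turn_def)
  next
    case False
    with Binary \<phi> obtain \<eta> mv where "good_turn \<Lambda> \<alpha> t (\<eta>, mv)"
      by fastforce
    with \<phi> show ?thesis
      by (intro exI[of _ "(First # \<eta>, mv)"]) (auto simp: good_turn_def)
  qed
next
  case (Modal L R s t)
  then obtain \<alpha> where \<phi>: "\<phi> = modal_fm s \<alpha>" "follows t \<alpha>" "\<alpha> \<in> formulas \<Lambda>"
    by (auto simp: modal_fm_in_formulas)
  with Modal obtain \<eta> mv where "good_turn \<Lambda> \<alpha> t (\<eta>, mv)"
    by fastforce
  with \<phi> show ?case
    by (intro exI[of _ "(First # \<eta>, mv)"]) (auto simp: good_turn_def)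
qed

text \<open>Legality and the final formula come from the invariant \<open>follows\<close>;
  termination comes from counting rounds against the size of \<phi>.\<close>

lemma winning_on_models_if_separates:
  assumes "separates \<phi> C D" and "\<phi> \<in> formulas \<Lambda>" and "\<mu> \<phi> < m"
  shows "\<exists>\<sigma>. winning_on_models \<Lambda> \<mu> m C D \<sigma>"
proof
  \<comment> \<open>The choice depends on the history only through the current position.\<close>
  define \<sigma> where "\<sigma> h = (SOME x. good_turn \<Lambda> \<phi> (position C D h) x)" for h
  have good: "good_turn \<Lambda> \<phi> (position C D h) (\<sigma> h)"
    if "follows (position C D h) \<phi>" "\<not> closed_tree (position C D h)" for h
    unfolding \<sigma>_def using good_turn_exists[OF that(1) assms(2) that(2)] by (rule someI_ex)
  have inv: "follows (position C D h) \<phi> \<and> played (position C D h) = length h"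
    if "partial_match \<Lambda> C D \<sigma> h" for h
    using that
  proof induction
    case start
    with assms show ?case by simp
  next
    case (round h \<eta> mv L R g)
    then have "good_turn \<Lambda> \<phi> (position C D h) (\<eta>, mv)"
      \<comment> \<open>A head was found at \<eta>, so the position is not closed and
        \<open>good\<close> applies.\<close>
      using good[of h] head_at_closed_tree[of "position C D h" \<eta>] by fastforce
    with round show ?case
      by (auto simp: good_turn_def played_graft played_expand)
  qed
  show "winning_on_models \<Lambda> \<mu> m C D \<sigma>"
    unfolding winning_on_models_def
  proof (intro conjI allI impI notI)
    fix h assume h: "partial_match \<Lambda> C D \<sigma> h"
    show "if closed_tree (position C D h) then \<mu> (tree_fm (position C D h)) < m
          else legal_turn \<Lambda> (position C D h) (\<sigma> h)"
      using inv[OF h] good[of h] assms(3) tree_fm_follows[of "position C D h" \<phi>]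
      by (auto simp: good_turn_def legal_turn_def)
  next
    assume "\<exists>s. \<forall>n. partial_match \<Lambda> C D \<sigma> (map s [0..<n])"
    then obtain s where s: "\<And>n. partial_match \<Lambda> C D \<sigma> (map s [0..<n])"
      by blast
    \<comment> \<open>One round more than \<open>played_follows\<close> allows.\<close>
    from inv[OF s[of "2 * size \<phi> + 2"]] show False
      using played_follows by fastforce
  qed
qed


subsection \<open>The greedy Hydra\<close>

text \<open>The largest legal reply. With all accessible points in the daughter, what holds of them
  there decides the modal formula at the parent.\<close>

fun greedy :: "('w, 'p) pmodel set \<Rightarrow> ('w, 'p) pmodel set \<Rightarrow> ('w, 'p) move \<Rightarrow> ('w, 'p) reply" where
  "greedy L R (Play_Modal s f) = (\<lambda>a. if a \<in> hydra_side s L R then accessible s a else {})"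
| "greedy L R _ = (\<lambda>a. {})"

lemma legal_reply_greedy: "legal_reply L R mv (greedy L R mv)"
  by (cases mv) auto

primrec label :: "('w, 'p) gtree \<Rightarrow> ('w, 'p) pmodel set \<times> ('w, 'p) pmodel set" where
  "label (Head L R) = (L, R)"
| "label (Stub L R s) = (L, R)"
| "label (Binary L R s t u) = (L, R)"
| "label (Modal L R s t) = (L, R)"

text \<open>Restores a subtree to the head it was when its parent was played, so that each round can
  be checked locally in the finished tree.\<close>

definition as_head :: "('w, 'p) gtree \<Rightarrow> ('w, 'p) gtree" where
  "as_head t = case_prod Head (label t)"

definition greedy_step :: "lang \<Rightarrow> ('w, 'p) gtree \<Rightarrow> bool" where
  "greedy_step \<Lambda> T \<longleftrightarrow> (\<exists>mv. legal_move \<Lambda> (fst (label T)) (snd (label T)) mv \<and>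
     T = expand (fst (label T)) (snd (label T)) mv (greedy (fst (label T)) (snd (label T)) mv))"

primrec greedily_played :: "lang \<Rightarrow> ('w, 'p) gtree \<Rightarrow> bool" where
  "greedily_played \<Lambda> (Head L R) \<longleftrightarrow> True"
| "greedily_played \<Lambda> (Stub L R s) \<longleftrightarrow> greedy_step \<Lambda> (Stub L R s)"
| "greedily_played \<Lambda> (Binary L R s t u) \<longleftrightarrow>
     greedy_step \<Lambda> (Binary L R s (as_head t) (as_head u)) \<and>
     greedily_played \<Lambda> t \<and> greedily_played \<Lambda> u"
| "greedily_played \<Lambda> (Modal L R s t) \<longleftrightarrow>
     greedy_step \<Lambda> (Modal L R s (as_head t)) \<and> greedily_played \<Lambda> t"

lemma label_expand: "label (expand L R mv g) = (L, R)"
  by (cases "(L, R, mv, g)" rule: expand.cases) auto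

lemma greedily_played_expand:
  assumes "legal_move \<Lambda> L R mv"
  shows "greedily_played \<Lambda> (expand L R mv (greedy L R mv))"
proof -
  have "greedy_step \<Lambda> (expand L R mv (greedy L R mv))"
    using assms by (auto simp: greedy_step_def label_expand)
  then show ?thesis
    by (cases "(L, R, mv, greedy L R mv)" rule: expand.cases) (auto simp: as_head_def)
qed

text \<open>Grafting must not change what \<open>as_head\<close> sees of a daughter, or the round
  played at its parent could no longer be recognised.\<close>

lemma label_graft:
  "head_at T \<eta> = Some (L, R) \<Longrightarrow> label v = (L, R) \<Longrightarrow> label (graft T \<eta> v) = label T"
  by (induction T \<eta> rule: head_at.induct) auto

lemma greedily_played_graft:
  "head_at T \<eta> = Some (L, R) \<Longrightarrow> greedily_played \<Lambda> T \<Longrightarrow> label v = (L, R) \<Longrightarrow>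
   greedily_played \<Lambda> v \<Longrightarrow> greedily_played \<Lambda> (graft T \<eta> v)"
  by (induction T \<eta> rule: head_at.induct) (auto simp: as_head_def label_graft)

lemma greedy_step_Stub:
  "greedy_step \<Lambda> (Stub L R s) \<Longrightarrow> legal_move \<Lambda> L R (Play_Stub s)"
  \<comment> \<open>\<open>expand\<close> is on the right of the equation in
    \<open>greedy_step\<close>; inverting it through \<open>sym\<close> recovers the move from the
    tree.\<close>
  unfolding greedy_step_def by (auto elim!: expand.elims[OF sym])

lemma greedy_step_Binary:
  assumes "greedy_step \<Lambda> (Binary L R s (Head X X') (Head Y Y'))"
    and "separates \<alpha> X X'" and "separates \<beta> Y Y'"
  shows "separates (bin_fm s \<alpha> \<beta>) L R"
  using assms unfolding greedy_step_def separates_def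
  by (auto elim!: expand.elims[OF sym])

text \<open>On Hercules' side the chosen points are witnesses, for or against \<alpha>; on the
  Hydra's side the daughter contains every accessible point, which excludes such witnesses.\<close>

lemma greedy_step_Modal:
  assumes "greedy_step \<Lambda> (Modal L R s (Head X Y))" and "separates \<alpha> X Y"
  shows "separates (modal_fm s \<alpha>) L R"
  using assms unfolding greedy_step_def separates_def
  by (auto elim!: expand.elims[OF sym]) blast+

lemma greedy_step_Modal_lang:
  "greedy_step \<Lambda> (Modal L R s t) \<Longrightarrow> s \<in> {SEx, SAll} \<Longrightarrow> \<Lambda> = L_Dia_U"
  unfolding greedy_step_def by (auto elim!: expand.elims[OF sym])

text \<open>Separation passes from the stubs up to the root. Membership in the language holds
  because universal moves are legal only in \<open>L_Dia_U\<close>.\<close>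

lemma separates_if_greedily_played:
  "greedily_played \<Lambda> T \<Longrightarrow> closed_tree T \<Longrightarrow>
   tree_fm T \<in> formulas \<Lambda> \<and> separates (tree_fm T) (fst (label T)) (snd (label T))"
proof (induction T)
  case (Head L R)
  then show ?case by simp
next
  case (Stub L R s)
  then have "legal_move \<Lambda> L R (Play_Stub s)"
    by (simp add: greedy_step_Stub)
  then show ?case
    by (cases s; cases \<Lambda>) (auto simp: separates_def)
next
  case (Binary L R s t u)
  then show ?case
    by (auto simp: as_head_def tree_fm_Binary bin_fm_in_formulas split_def
        simp del: tree_fm.simps(5-) intro: greedy_step_Binary)
next
  case (Modal L R s t)
  then show ?case
    by (auto simp: as_head_def tree_fm_Modal modal_fm_in_formulas split_def
        simp del: tree_fm.simps(5-) intro: greedy_step_Modal dest: greedy_step_Modal_lang)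
qed

text \<open>Dependent choice: \<open>run n\<close> is the history after \<open>n\<close> extensions,
  and its next round is entry \<open>n\<close> of the infinite sequence.\<close>

lemma infinite_run:
  assumes "Q []" and "\<And>h. Q h \<Longrightarrow> \<exists>x. Q (h @ [x])"
  shows "\<exists>s. \<forall>n. Q (map s [0..<n])"
proof -
  obtain nxt where nxt: "\<And>h. Q h \<Longrightarrow> Q (h @ [nxt h])"
    using assms(2) by metis
  define run where "run = rec_nat [] (\<lambda>_ h. h @ [nxt h])"
  have "map (\<lambda>n. nxt (run n)) [0..<n] = run n" for n
    by (induction n) (auto simp: run_def)
  moreover have "Q (run n)" for n
    by (induction n) (auto simp: run_def assms(1) nxt)
  ultimately show ?thesis by metis
qed

text \<open>One match suffices, the one against the greedy Hydra: it must close, and its closed tree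
  yields the formula.\<close>

lemma separating_formula_if_winning:
  assumes "winning_on_models \<Lambda> \<mu> m C D \<sigma>"
  shows "\<exists>\<phi> \<in> formulas \<Lambda>. \<mu> \<phi> < m \<and> separates \<phi> C D"
proof -
  define Q where "Q h \<longleftrightarrow> partial_match \<Lambda> C D \<sigma> h \<and> greedily_played \<Lambda> (position C D h) \<and>
    label (position C D h) = (C, D)" for h
  have "\<exists>h. Q h \<and> closed_tree (position C D h)"
  proof (rule ccontr)
    \<comment> \<open>If no greedy match closes, Hercules always has a legal turn and the greedy
      reply prolongs the match, giving the infinite match that a winning strategy excludes.\<close>
    assume open_run: "\<nexists>h. Q h \<and> closed_tree (position C D h)"
    have "Q []"
      by (simp add: Q_def partial_match.start)
    moreover have "\<exists>x. Q (h @ [x])" if h: "Q h" for h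
    proof -
      obtain \<eta> mv where \<sigma>: "\<sigma> h = (\<eta>, mv)"
        by (cases "\<sigma> h") blast
      have "legal_turn \<Lambda> (position C D h) (\<sigma> h)"
        using assms h open_run by (metis winning_on_models_def Q_def)
      with \<sigma> obtain L R
        where turn: "head_at (position C D h) \<eta> = Some (L, R)" "legal_move \<Lambda> L R mv"
        by (auto simp: legal_turn_def)
      then have "Q (h @ [(\<eta>, mv, greedy L R mv)])"
        using h \<sigma> unfolding Q_def
        by (auto simp: label_graft label_expand legal_reply_greedy
            intro!: partial_match.round greedily_played_graft greedily_played_expand)
      then show ?thesis ..
    qed
    ultimately obtain s where "\<forall>n. Q (map s [0..<n])"
      using infinite_run[of Q] by blast
    with assms show False
      by (auto simp: winning_on_models_def Q_def)
  qed
  then obtain h where h: "Q h" "closed_tree (position C D h)"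
    by blast
  with assms have "\<mu> (tree_fm (position C D h)) < m"
    by (metis winning_on_models_def Q_def)
  with h separates_if_greedily_played[of \<Lambda> "position C D h"] show ?thesis
    by (auto simp: Q_def)
qed

section \<open>From separation of pointed models to validity on frames\<close>

theorem theorem4p3:
  fixes \<Lambda> :: lang
    and A B :: "'w kframe set"
    and \<mu> :: "'p::{countable, infinite} fm \<Rightarrow> nat"
    and m :: nat
  assumes "\<forall>F \<in> A. is_frame F" and "\<forall>F \<in> B. is_frame F"
  shows "hercules_wins_on_frames \<Lambda> \<mu> m A B \<longleftrightarrow>
    (\<exists>\<phi> \<in> formulas \<Lambda>. \<mu> \<phi> < m \<and> (\<forall>F \<in> A. valid_on F \<phi>) \<and> (\<forall>F \<in> B. \<not> valid_on F \<phi>))"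
proof
  assume "hercules_wins_on_frames \<Lambda> \<mu> m A B"
  then obtain \<beta> \<sigma> where \<beta>: "\<forall>F \<in> B. pmodel_on (\<beta> F :: ('w, 'p) pmodel) F"
    and win: "\<And>A'. (\<forall>a \<in> A'. \<exists>F \<in> A. pmodel_on a F) \<Longrightarrow>
      winning_on_models \<Lambda> \<mu> m A' (\<beta> ` B) (\<sigma> A')"
    by (auto simp: hercules_wins_on_frames_def winning_on_frames_def)
  \<comment> \<open>With every pointed model on frames of \<open>A\<close> included, truth
    throughout \<open>A'\<close> amounts to validity on each of these frames.\<close>
  define A' :: "('w, 'p) pmodel set" where "A' = {a. \<exists>F \<in> A. pmodel_on a F}"
  have "winning_on_models \<Lambda> \<mu> m A' (\<beta> ` B) (\<sigma> A')"
    by (rule win) (simp add: A'_def)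
  then obtain \<phi> where \<phi>: "\<phi> \<in> formulas \<Lambda>" "\<mu> \<phi> < m" "separates \<phi> A' (\<beta> ` B)"
    using separating_formula_if_winning by blast
  have "valid_on F \<phi>" if "F \<in> A" for F
    using \<phi>(3) that by (force simp: valid_on_def separates_def A'_def pmodel_on_def holds_def)
  moreover have "\<not> valid_on F \<phi>" if "F \<in> B" for F
    using \<phi>(3) \<beta> that by (force simp: valid_on_def separates_def pmodel_on_def holds_def)
  ultimately show "\<exists>\<phi> \<in> formulas \<Lambda>. \<mu> \<phi> < m \<and> (\<forall>F \<in> A. valid_on F \<phi>) \<and> (\<forall>F \<in> B. \<not> valid_on F \<phi>)"
    using \<phi> by blast
next
  assume "\<exists>\<phi> \<in> formulas \<Lambda>. \<mu> \<phi> < m \<and> (\<forall>F \<in> A. valid_on F \<phi>) \<and> (\<forall>F \<in> B. \<not> valid_on F \<phi>)"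
  then obtain \<phi> where \<phi>: "\<phi> \<in> formulas \<Lambda>" "\<mu> \<phi> < m"
    and valid: "\<forall>F \<in> A. valid_on F \<phi>" and invalid: "\<forall>F \<in> B. \<not> valid_on F \<phi>"
    by blast
  \<comment> \<open>Hercules' opening choice is a countermodel to \<phi> on each frame of
    \<open>B\<close>, fixed before \<open>A'\<close> is known.\<close>
  have "\<exists>b :: ('w, 'p) pmodel. pmodel_on b F \<and> \<not> holds b \<phi>" if "F \<in> B" for F
    using invalid that by (force simp: valid_on_def pmodel_on_def holds_def)
  then obtain \<beta> where \<beta>: "\<And>F. F \<in> B \<Longrightarrow>
      pmodel_on (\<beta> F :: ('w, 'p) pmodel) F \<and> \<not> holds (\<beta> F) \<phi>"
    by metis
  have "\<exists>\<sigma>. winning_on_models \<Lambda> \<mu> m A' (\<beta> ` B) \<sigma>"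
    if A': "\<forall>a \<in> A'. \<exists>F \<in> A. pmodel_on a F" for A'
  proof (rule winning_on_models_if_separates)
    show "separates \<phi> A' (\<beta> ` B)"
      using A' valid \<beta> by (fastforce simp: separates_def valid_on_def pmodel_on_def holds_def)
  qed (use \<phi> in auto)
  \<comment> \<open>Choice over all legal \<open>A'\<close> combines the strategies into one that
    depends on the Hydra's class.\<close>
  then obtain \<sigma> where "\<And>A'. \<forall>a \<in> A'. \<exists>F \<in> A. pmodel_on a F \<Longrightarrow>
      winning_on_models \<Lambda> \<mu> m A' (\<beta> ` B) (\<sigma> A')"
    by metis
  with \<beta> show "hercules_wins_on_frames \<Lambda> \<mu> m A B"
    by (auto simp: hercules_wins_on_frames_def winning_on_frames_def)
qed

end
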